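(* Let $R$ be a commutative ring with identity and let $\mathsf{K}(R)$ be the set of $R$-submodules of $T(R)$. For each $I \in \mathsf{K}(R)$, let $$I_u = \{x \in T(R) \mid xJ \subseteq I \text{ for some } J \in \mathrm{rGV}(R)\}.$$ Then the following hold for all $a \in T(R)$ and $I, J \in \mathsf{K}(R)$: (1) $I_u \in \mathsf{K}(R)$. (2) $aI_u \subseteq (aI)_u$, and equality holds when $a$ is regular. (3) $I \subseteq I_u$, and $I \subseteq J$ implies $I_u \subseteq J_u$. (4) $(I_u)_u = I_u$. (5) $R_u = R$. (6) $(0)_u = (0)$. (7) $I_u = \bigcup \{(I_0)_u \mid I_0 \in \mathsf{K}(R),\ I_0 \subseteq I,\ I_0 \text{ finitely generated}\}$. Thus, the map $u : \mathsf{K}(R) \to \mathsf{K}(R)$, $I \mapsto I_u$, is a reduced star operation of finite type on $R$.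
   Context: All rings are commutative with nonzero identity. $T(R)$ is the total quotient ring of $R$; a regular element is a non-zero-divisor; an $R$-submodule of $T(R)$ is regular if it contains a regular element of $R$. For $I \in \mathsf{K}(R)$, $I^{-1} = \{x \in T(R) : xI \subseteq R\}$. A fractional ideal is an $I \in \mathsf{K}(R)$ with $dI \subseteq R$ for some regular $d \in R$. $\mathrm{rGV}(R)$ is the set of finitely generated regular fractional ideals $J$ of $R$ with $J^{-1} = R$. A star operation on $R$ is a map $* : \mathsf{K}(R) \to \mathsf{K}(R)$, $I \mapsto I_*$, such that for all $I, J \in \mathsf{K}(R)$ and $a \in T(R)$: (i) $R_* = R$; (ii) $aI_* \subseteq (aI)_*$, with equality when $a$ is regular; (iii) $I \subseteq I_*$, and $I \subseteq J$ implies $I_* \subseteq J_*$; (iv) $(I_* )_* = I_*$. It is of finite type if $I_* = \bigcup\{J_* : J \in \mathsf{K}(R) \text{ finitely generated},\ J \subseteq I\}$ for all $I$, and reduced if $(0)_* = (0)$. *)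

theory Defs
  imports Complex_Main "HOL-Library.Set_Algebras"
begin

section \<open>Regular elements\<close>

definition regular :: "'a::comm_ring_1 \<Rightarrow> bool" where
  "regular a \<longleftrightarrow> (\<forall>x. a * x = 0 \<longrightarrow> x = 0)"

lemma regular_1 [simp]: "regular 1"
  by (simp add: regular_def)

lemma regular_mult [intro, simp]: "regular a \<Longrightarrow> regular b \<Longrightarrow> regular (a * b)"
  unfolding regular_def mult.assoc by blast

lemma regular_cancel:
  assumes a: "regular a"
  shows "a * x = a * y \<longleftrightarrow> x = y"
proof
  assume "a * x = a * y"
  hence "a * (x - y) = 0" by (simp add: right_diff_distrib)
  hence "x - y = 0" using a unfolding regular_def by blast
  thus "x = y" by simp
qed simp


section \<open>The total quotient ring\<close>

text \<open>
  The ring \<open>R\<close> is the type \<open>'a\<close>; the type \<open>'a tq\<close> is the localization of \<open>R\<close> at the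
  multiplicative set of all its regular elements. Since the denominators are regular,
  \<open>a / b = c / d\<close> amounts to \<open>a * d = c * b\<close>, with no further factor.
\<close>

definition tqrel :: "'a::comm_ring_1 \<times> 'a \<Rightarrow> 'a \<times> 'a \<Rightarrow> bool" where
  "tqrel = (\<lambda>x y. regular (snd x) \<and> regular (snd y) \<and> fst x * snd y = fst y * snd x)"

lemma tqrel_iff [simp]:
  "tqrel x y \<longleftrightarrow> regular (snd x) \<and> regular (snd y) \<and> fst x * snd y = fst y * snd x"
  by (simp add: tqrel_def)

lemma part_equivp_tqrel: "part_equivp (tqrel :: 'a::comm_ring_1 \<times> 'a \<Rightarrow> _)"
proof (rule part_equivpI)
  show "\<exists>x :: 'a \<times> 'a. tqrel x x"
    by (rule exI[where x = "(0, 1)"]) simp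
  show "symp (tqrel :: 'a \<times> 'a \<Rightarrow> _)"
    by (simp add: symp_def)
  show "transp (tqrel :: 'a \<times> 'a \<Rightarrow> _)"
  proof (rule transpI, unfold split_paired_all)
    fix a b a' b' a'' b'' :: 'a
    assume A: "tqrel (a, b) (a', b')"
    assume B: "tqrel (a', b') (a'', b'')"
    have "b' * (a * b'') = b'' * (a * b')" by (simp add: ac_simps)
    also from A have "a * b' = a' * b" by auto
    also have "b'' * (a' * b) = b * (a' * b'')" by (simp add: ac_simps)
    also from B have "a' * b'' = a'' * b'" by auto
    also have "b * (a'' * b') = b' * (a'' * b)" by (simp add: ac_simps)
    finally have "b' * (a * b'') = b' * (a'' * b)" .
    moreover from B have "regular b'" by auto
    ultimately have "a * b'' = a'' * b" by (simp add: regular_cancel)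
    with A B show "tqrel (a, b) (a'', b'')" by auto
  qed
qed

quotient_type (overloaded) 'a tq = "'a::comm_ring_1 \<times> 'a" / partial: "tqrel"
  by (rule part_equivp_tqrel)

lift_definition Tq :: "'a::comm_ring_1 \<Rightarrow> 'a \<Rightarrow> 'a tq"
  is "\<lambda>a b. if regular b then (a, b) else (0, 1)"
  by simp

lemma Tq_cases [cases type: tq]:
  obtains (Tq) a b where "q = Tq a b" "regular b"
  by transfer auto

lemma eq_Tq: "regular b \<Longrightarrow> regular d \<Longrightarrow> Tq a b = Tq c d \<longleftrightarrow> a * d = c * b"
  by transfer simp

instantiation tq :: (comm_ring_1) comm_ring_1
begin

lift_definition zero_tq :: "'a tq" is "(0, 1)" by simp

lift_definition one_tq :: "'a tq" is "(1, 1)" by simp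

lift_definition plus_tq :: "'a tq \<Rightarrow> 'a tq \<Rightarrow> 'a tq"
  is "\<lambda>q r. (fst q * snd r + fst r * snd q, snd q * snd r)"
proof (clarsimp, goal_cases)
  case (1 a b a' b' c d c' d')
  have "(a * d + c * b) * (b' * d') = (a * b') * (d * d') + (c * d') * (b * b')"
    by (simp add: algebra_simps)
  also have "\<dots> = (a' * b) * (d * d') + (c' * d) * (b * b')"
    using 1 by simp
  also have "\<dots> = (a' * d' + c' * b') * (b * d)"
    by (simp add: algebra_simps)
  finally show ?case .
qed

lift_definition uminus_tq :: "'a tq \<Rightarrow> 'a tq"
  is "\<lambda>x. (- fst x, snd x)"
  by simp

definition diff_tq_def: "q - r = q + - (r :: 'a tq)"

lift_definition times_tq :: "'a tq \<Rightarrow> 'a tq \<Rightarrow> 'a tq"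
  is "\<lambda>q r. (fst q * fst r, snd q * snd r)"
proof (clarsimp, goal_cases)
  case (1 a b a' b' c d c' d')
  have "a * c * (b' * d') = (a * b') * (c * d')" by (simp add: ac_simps)
  also have "\<dots> = (a' * b) * (c' * d)" using 1 by simp
  also have "\<dots> = a' * c' * (b * d)" by (simp add: ac_simps)
  finally show ?case .
qed

lemma Zero_tq: "0 = Tq 0 1"
  by transfer simp

lemma One_tq: "1 = Tq 1 1"
  by transfer simp

lemma add_Tq: "regular b \<Longrightarrow> regular d \<Longrightarrow> Tq a b + Tq c d = Tq (a * d + c * b) (b * d)"
  by transfer simp

lemma minus_Tq: "regular b \<Longrightarrow> - Tq a b = Tq (- a) b"
  by transfer simp

lemma mult_Tq: "regular b \<Longrightarrow> regular d \<Longrightarrow> Tq a b * Tq c d = Tq (a * c) (b * d)"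
  by transfer simp

instance
proof
  fix q r s :: "'a tq"
  note simps = eq_Tq Zero_tq One_tq add_Tq minus_Tq mult_Tq algebra_simps
  show "(q * r) * s = q * (r * s)"
    by (cases q, cases r, cases s) (simp add: simps)
  show "q * r = r * q"
    by (cases q, cases r) (simp add: simps)
  show "1 * q = q"
    by (cases q) (simp add: simps)
  show "(q + r) + s = q + (r + s)"
    by (cases q, cases r, cases s) (simp add: simps)
  show "q + r = r + q"
    by (cases q, cases r) (simp add: simps)
  show "0 + q = q"
    by (cases q) (simp add: simps)
  show "- q + q = 0"
    by (cases q) (simp add: simps)
  show "q - r = q + - r"
    by (simp add: diff_tq_def)
  show "(q + r) * s = q * s + r * s"
    by (cases q, cases r, cases s) (simp add: simps)
  show "(0 :: 'a tq) \<noteq> 1"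
    by (simp add: simps)
qed

end

definition emb :: "'a::comm_ring_1 \<Rightarrow> 'a tq" where
  "emb a = Tq a 1"

lemma emb_0: "emb 0 = 0"
  and emb_1: "emb 1 = 1"
  and emb_add: "emb (a + b) = emb a + emb b"
  and emb_minus: "emb (- a) = - emb a"
  and emb_mult: "emb (a * b) = emb a * emb b"
  by (simp_all add: emb_def Zero_tq One_tq add_Tq minus_Tq mult_Tq)

lemma inj_emb: "inj emb"
  by (auto intro!: injI simp: emb_def eq_Tq)

lemma emb_regular_unit: "regular d \<Longrightarrow> emb d dvd 1"
  by (rule dvdI[of _ _ "Tq 1 d"]) (simp add: emb_def One_tq mult_Tq eq_Tq)

lemma tq_eq_quotient: "\<exists>a d. regular d \<and> q * emb d = emb a"
proof (cases q)
  case (Tq a b)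
  then have "q * emb b = emb a" by (simp add: emb_def mult_Tq eq_Tq)
  with Tq show ?thesis by blast
qed


section \<open>Submodules of the total quotient ring\<close>

definition tscale :: "'a::comm_ring_1 \<Rightarrow> 'a tq \<Rightarrow> 'a tq" where
  "tscale r x = emb r * x"

lemma module_tscale: "module tscale"
  by unfold_locales (simp_all add: tscale_def emb_add emb_mult emb_1 algebra_simps)

definition K :: "'a::comm_ring_1 tq set set" where
  "K = {I. module.subspace tscale I}"

definition fin_gen :: "'a::comm_ring_1 tq set \<Rightarrow> bool" where
  "fin_gen I \<longleftrightarrow> (\<exists>S. finite S \<and> I = module.span tscale S)"

text \<open>The ring \<open>R\<close>, regarded as a subset of its total quotient ring.\<close>

definition base_ring :: "'a::comm_ring_1 tq set" where
  "base_ring = range emb"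

definition regular_submodule :: "'a::comm_ring_1 tq set \<Rightarrow> bool" where
  "regular_submodule I \<longleftrightarrow> (\<exists>d. regular d \<and> emb d \<in> I)"

definition fractional_ideal :: "'a::comm_ring_1 tq set \<Rightarrow> bool" where
  "fractional_ideal I \<longleftrightarrow> I \<in> K \<and> (\<exists>d. regular d \<and> emb d *o I \<subseteq> base_ring)"

definition inv_submodule :: "'a::comm_ring_1 tq set \<Rightarrow> 'a tq set" where
  "inv_submodule I = {x. x *o I \<subseteq> base_ring}"

definition rGV :: "'a::comm_ring_1 tq set set" where
  "rGV = {J. fin_gen J \<and> regular_submodule J \<and> fractional_ideal J \<and> inv_submodule J = base_ring}"


section \<open>Star operations\<close>

text \<open>
  A map \<open>K(R) \<rightarrow> K(R)\<close> is represented by a function on all subsets of the total quotient ring;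
  its values outside of \<open>K\<close> are irrelevant.
  In the homogeneity condition, \<open>regular a\<close> refers to the ring \<open>'a tq\<close>.
\<close>

definition star_operation :: "('a::comm_ring_1 tq set \<Rightarrow> 'a tq set) \<Rightarrow> bool" where
  "star_operation s \<longleftrightarrow>
     (\<forall>I\<in>K. s I \<in> K) \<and>
     s base_ring = base_ring \<and>
     (\<forall>a. \<forall>I\<in>K. a *o s I \<subseteq> s (a *o I) \<and> (regular a \<longrightarrow> a *o s I = s (a *o I))) \<and>
     (\<forall>I\<in>K. I \<subseteq> s I) \<and>
     (\<forall>I\<in>K. \<forall>J\<in>K. I \<subseteq> J \<longrightarrow> s I \<subseteq> s J) \<and>
     (\<forall>I\<in>K. s (s I) = s I)"

definition finite_type :: "('a::comm_ring_1 tq set \<Rightarrow> 'a tq set) \<Rightarrow> bool" where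
  "finite_type s \<longleftrightarrow> (\<forall>I\<in>K. s I = \<Union> {s J | J. J \<in> K \<and> fin_gen J \<and> J \<subseteq> I})"

definition reduced :: "('a::comm_ring_1 tq set \<Rightarrow> 'a tq set) \<Rightarrow> bool" where
  "reduced s \<longleftrightarrow> s {0} = {0}"

definition u_op :: "'a::comm_ring_1 tq set \<Rightarrow> 'a tq set" where
  "u_op I = {x. \<exists>J\<in>rGV. x *o J \<subseteq> I}"

end

theory Submission
  imports Defs
begin

text \<open>
  If \<open>span S\<close> and \<open>span T\<close> are in \<open>rGV\<close>, then so is their product \<open>span (S * T)\<close>, which lies in both
  factors. Hence finitely many elements of \<open>I\<^sub>u\<close> are multiplied into \<open>I\<close> by a common element of
  \<open>rGV\<close>; this makes \<open>I\<^sub>u\<close> a submodule and, as the elements of \<open>rGV\<close> are finitely generated, gives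
  \<open>(I\<^sub>u)\<^sub>u = I\<^sub>u\<close>. The remaining properties use that an element of \<open>rGV\<close> contains a unit of the
  total quotient ring.
\<close>

section \<open>Submodules of the total quotient ring and their multiples\<close>

interpretation tq: module tscale
  by (rule module_tscale)

lemma K_iff_subspace: "I \<in> K \<longleftrightarrow> tq.subspace I"
  by (simp add: K_def)

text \<open>Makes the library facts on images under linear maps available for multiplication by any
  \<open>x\<close> of the total quotient ring.\<close>

lemma linear_times: "module_hom tscale tscale (\<lambda>y. x * y)"
  by unfold_locales (simp_all add: tscale_def algebra_simps)

lemma elt_set_times_eq_image: "x *o I = (\<lambda>y. x * y) ` I"
  by (auto simp: elt_set_times_def)

lemma elt_set_times_span: "x *o tq.span S = tq.span (x *o S)"
  unfolding elt_set_times_eq_image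
  by (rule module_hom.span_image[OF linear_times, symmetric])

lemma elt_set_times_in_K: "I \<in> K \<Longrightarrow> x *o I \<in> K"
  unfolding elt_set_times_eq_image K_iff_subspace
  by (rule module_hom.subspace_image[OF linear_times])

lemma fin_gen_elt_set_times: "fin_gen I \<Longrightarrow> fin_gen (x *o I)"
  unfolding fin_gen_def by (metis elt_set_times_span elt_set_times_eq_image finite_imageI)

lemma elt_set_times_subset_iff: "x *o A \<subseteq> I \<longleftrightarrow> (\<forall>y\<in>A. x * y \<in> I)"
  by (auto simp: elt_set_times_def)

lemma elt_set_times_span_subset_iff:
  assumes "I \<in> K"
  shows "x *o tq.span S \<subseteq> I \<longleftrightarrow> (\<forall>s\<in>S. x * s \<in> I)"
  using assms tq.span_minimal[of "x *o S" I] tq.span_superset[of "x *o S"]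
  unfolding elt_set_times_span K_iff_subspace elt_set_times_subset_iff[symmetric] by blast

text \<open>Tests a product of submodules in two stages: only generators \<open>s\<close> of the
  first factor matter, and each is moved into the multiplier of the second.\<close>

lemma elt_set_times_span_times_subset_iff:
  assumes "I \<in> K"
  shows "x *o tq.span (S * T) \<subseteq> I \<longleftrightarrow> (\<forall>s\<in>S. (x * s) *o tq.span T \<subseteq> I)"
  by (auto simp: elt_set_times_span_subset_iff[OF assms] set_times_def mult.assoc)

lemma base_ring_eq_span: "base_ring = tq.span {1 :: 'a::comm_ring_1 tq}"
  by (auto simp: base_ring_def tq.span_singleton tscale_def)

lemma base_ring_in_K: "base_ring \<in> K"
  by (simp add: base_ring_eq_span K_iff_subspace)

lemma one_in_base_ring: "1 \<in> base_ring"
  by (simp add: base_ring_eq_span tq.span_base)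

lemma K_mult_base_ring:
  assumes "I \<in> K" "x \<in> I" "r \<in> base_ring"
  shows "x * r \<in> I"
  using assms tq.subspace_scale[of I x]
  by (auto simp: K_iff_subspace base_ring_def tscale_def mult.commute)

section \<open>The set \<open>rGV\<close> and its closure under products\<close>

text \<open>
  Since \<open>1 \<in> R = J\<^sup>-\<^sup>1\<close> forces \<open>J \<subseteq> R\<close>, being a fractional ideal is automatic.
\<close>

lemma rGV_iff:
  "J \<in> rGV \<longleftrightarrow> fin_gen J \<and> regular_submodule J \<and> J \<subseteq> base_ring \<and>
     (\<forall>x. x *o J \<subseteq> base_ring \<longrightarrow> x \<in> base_ring)"
  (is "_ \<longleftrightarrow> ?r")
proof
  assume J: "J \<in> rGV"
  then have inv: "x \<in> base_ring \<longleftrightarrow> x *o J \<subseteq> base_ring" for x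
    unfolding rGV_def inv_submodule_def by blast
  moreover have "J \<subseteq> base_ring"
    using inv[of 1] by (simp add: one_in_base_ring)
  ultimately show ?r
    using J by (simp add: rGV_def)
next
  assume r: ?r
  then have "J \<in> K"
    by (auto simp: fin_gen_def K_iff_subspace)
  moreover have "emb 1 *o J \<subseteq> base_ring"
    using r by (simp add: emb_1)
  ultimately have "fractional_ideal J"
    unfolding fractional_ideal_def using regular_1 by blast
  moreover have "x *o J \<subseteq> base_ring" if "x \<in> base_ring" for x
    using that r K_mult_base_ring[OF base_ring_in_K] by (auto simp: elt_set_times_subset_iff)
  ultimately show "J \<in> rGV"
    using r by (auto simp: rGV_def inv_submodule_def)
qed

lemma base_ring_in_rGV: "(base_ring :: 'a::comm_ring_1 tq set) \<in> rGV"
proof -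
  have "fin_gen (base_ring :: 'a tq set)"
    unfolding fin_gen_def base_ring_eq_span by blast
  moreover have "regular_submodule (base_ring :: 'a tq set)"
    unfolding regular_submodule_def using regular_1 one_in_base_ring by (metis emb_1)
  moreover have "x \<in> base_ring" if "x *o base_ring \<subseteq> base_ring" for x :: "'a tq"
    using that one_in_base_ring by (fastforce simp: elt_set_times_subset_iff)
  ultimately show ?thesis
    by (simp add: rGV_iff)
qed

text \<open>A regular element of the ring becomes invertible in the total quotient ring.\<close>

lemma rGV_obtain_unit:
  assumes "J \<in> rGV"
  obtains y z where "y \<in> J" "y * z = 1"
  using assms emb_regular_unit unfolding rGV_def regular_submodule_def dvd_def by force

text \<open>Linearity in one factor at a time: for fixed \<open>s\<close> the generators of
  \<open>T\<close> suffice, then for fixed \<open>y\<close> those of \<open>S\<close>.\<close>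

lemma span_times_mem:
  assumes "x \<in> tq.span S" "y \<in> tq.span T"
  shows "x * y \<in> tq.span (S * T)"
proof -
  have K: "tq.span (S * T) \<in> K"
    by (simp add: K_iff_subspace)
  have "s *o tq.span T \<subseteq> tq.span (S * T)" if "s \<in> S" for s
    using that by (auto simp: elt_set_times_span_subset_iff[OF K] intro: tq.span_base)
  then have "\<forall>s\<in>S. y * s \<in> tq.span (S * T)"
    using assms(2) unfolding elt_set_times_subset_iff mult.commute[of y] by blast
  then have "y *o tq.span S \<subseteq> tq.span (S * T)"
    by (simp only: elt_set_times_span_subset_iff[OF K])
  then show ?thesis
    using assms(1) unfolding elt_set_times_subset_iff mult.commute[of x] by blast
qed

text \<open>The inverse is computed factor by factor: if \<open>x * s\<close> multiplies
  \<open>span T\<close> into the ring, then \<open>x * s\<close> is in the ring, as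
  \<open>span T\<close> has inverse \<open>base_ring\<close>; if this holds for all
  \<open>s\<close>, the same property of \<open>span S\<close> puts \<open>x\<close> in the
  ring.\<close>

lemma rGV_span_times:
  assumes "finite S" "finite T" "tq.span S \<in> rGV" "tq.span T \<in> rGV"
  shows "tq.span (S * T) \<in> rGV"
proof -
  note R = base_ring_in_K
  have "fin_gen (tq.span (S * T))"
    unfolding fin_gen_def using assms(1,2) finite_set_times by blast
  moreover have "regular_submodule (tq.span (S * T))"
  proof -
    obtain c d where "regular c" "emb c \<in> tq.span S" "regular d" "emb d \<in> tq.span T"
      using assms(3,4) unfolding rGV_iff regular_submodule_def by blast
    then have "regular (c * d)" "emb (c * d) \<in> tq.span (S * T)"
      by (simp_all add: emb_mult span_times_mem)
    then show ?thesis
      unfolding regular_submodule_def by blast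
  qed
  moreover have "x \<in> base_ring \<longleftrightarrow> x *o tq.span (S * T) \<subseteq> base_ring" for x
  proof -
    have "x *o tq.span (S * T) \<subseteq> base_ring \<longleftrightarrow> (\<forall>s\<in>S. x * s \<in> base_ring)"
      using assms(4) unfolding elt_set_times_span_times_subset_iff[OF R]
      by (auto simp: rGV_def inv_submodule_def)
    also have "\<dots> \<longleftrightarrow> x *o tq.span S \<subseteq> base_ring"
      by (simp add: elt_set_times_span_subset_iff[OF R])
    also have "\<dots> \<longleftrightarrow> x \<in> base_ring"
      using assms(3) by (auto simp: rGV_def inv_submodule_def)
    finally show ?thesis ..
  qed
  \<comment> \<open>The case \<open>x = 1\<close> of the equivalence.\<close>
  moreover have "tq.span (S * T) \<subseteq> base_ring"
    using \<open>\<And>x. x \<in> base_ring \<longleftrightarrow> x *o tq.span (S * T) \<subseteq> base_ring\<close>[of 1]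
    by (simp add: one_in_base_ring)
  ultimately show ?thesis
    unfolding rGV_iff by blast
qed

lemma rGV_obtain_span:
  assumes "J \<in> rGV"
  obtains S where "finite S" "J = tq.span S"
  using assms by (auto simp: rGV_iff fin_gen_def)

section \<open>Closure properties of \<open>u_op\<close>\<close>

lemma u_op_mono: "I \<subseteq> J \<Longrightarrow> u_op I \<subseteq> u_op J"
  unfolding u_op_def by blast

lemma u_op_superset:
  assumes "I \<in> K"
  shows "I \<subseteq> u_op I"
  using K_mult_base_ring[OF assms] base_ring_in_rGV
  by (auto simp: u_op_def elt_set_times_subset_iff)

text \<open>Induction on \<open>A\<close>: the multiplier \<open>P\<close> of the earlier elements
  is replaced by its product with a multiplier \<open>J\<close> of the new one.\<close>

lemma u_op_common_multiplier:
  assumes "I \<in> K" "finite A" "A \<subseteq> u_op I"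
  shows "\<exists>P\<in>rGV. \<forall>x\<in>A. x *o P \<subseteq> I"
  using assms(2,3)
proof (induction A rule: finite_induct)
  case empty
  show ?case
    using base_ring_in_rGV by blast
next
  case (insert x A)
  then obtain P where P: "P \<in> rGV" "\<forall>y\<in>A. y *o P \<subseteq> I"
    by auto
  obtain J where J: "J \<in> rGV" "x *o J \<subseteq> I"
    using insert.prems by (auto simp: u_op_def)
  obtain S where S: "finite S" "J = tq.span S"
    using J(1) by (rule rGV_obtain_span)
  obtain T where T: "finite T" "P = tq.span T"
    using P(1) by (rule rGV_obtain_span)
  \<comment> \<open>Of the two factors in a generator \<open>s * t\<close>, one carries the given
    element into \<open>I\<close>; the other is a ring element, which the submodule \<open>I\<close>
    absorbs.\<close>
  have "S \<subseteq> base_ring" "T \<subseteq> base_ring"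
    using J(1) P(1) tq.span_superset[of S] tq.span_superset[of T]
    unfolding rGV_iff S(2) T(2) by blast+
  have IS: "x * (s * t) \<in> I" if "s \<in> S" "t \<in> T" for s t
  proof -
    have "x * s \<in> I"
      using J(2) that(1) S(2) by (auto simp: elt_set_times_subset_iff tq.span_base)
    then show ?thesis
      using K_mult_base_ring[OF assms(1), of "x * s" t] that(2) \<open>T \<subseteq> base_ring\<close>
      by (auto simp: mult.assoc)
  qed
  have IT: "y * (s * t) \<in> I" if "y \<in> A" "s \<in> S" "t \<in> T" for y s t
  proof -
    have "y * t \<in> I"
      using P(2) that(1,3) T(2) by (auto simp: elt_set_times_subset_iff tq.span_base)
    then show ?thesis
      using K_mult_base_ring[OF assms(1), of "y * t" s] that(2) \<open>S \<subseteq> base_ring\<close>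
      by (auto simp: ac_simps)
  qed
  have "\<forall>y\<in>insert x A. y *o tq.span (S * T) \<subseteq> I"
    using IS IT by (auto simp: elt_set_times_span_subset_iff[OF assms(1)] set_times_def)
  moreover have "tq.span (S * T) \<in> rGV"
    using rGV_span_times S T J(1) P(1) by blast
  ultimately show ?case
    by blast
qed

lemma u_op_in_K:
  assumes "I \<in> K"
  shows "u_op I \<in> K"
  unfolding K_iff_subspace
proof (rule tq.subspaceI)
  have I: "tq.subspace I"
    using assms by (simp add: K_iff_subspace)
  show "0 \<in> u_op I"
    using u_op_superset[OF assms] tq.subspace_0[OF I] by blast
  show "x + y \<in> u_op I" if xy: "x \<in> u_op I" "y \<in> u_op I" for x y
  proof -
    obtain P where "P \<in> rGV" "x *o P \<subseteq> I" "y *o P \<subseteq> I"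
      using u_op_common_multiplier[OF assms, of "{x, y}"] xy by auto
    then show ?thesis
      using tq.subspace_add[OF I]
      by (auto simp: u_op_def elt_set_times_subset_iff distrib_right intro!: bexI[of _ P])
  qed
  show "tscale c x \<in> u_op I" if "x \<in> u_op I" for c x
  proof -
    obtain P where "P \<in> rGV" "x *o P \<subseteq> I"
      using \<open>x \<in> u_op I\<close> by (auto simp: u_op_def)
    moreover have "tscale c x * y = tscale c (x * y)" for y
      by (simp add: tscale_def mult.assoc)
    ultimately show ?thesis
      using tq.subspace_scale[OF I]
      by (auto simp: u_op_def elt_set_times_subset_iff intro!: bexI[of _ P])
  qed
qed

lemma u_op_idem:
  assumes "I \<in> K"
  shows "u_op (u_op I) = u_op I"
proof
  show "u_op I \<subseteq> u_op (u_op I)"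
    using assms by (intro u_op_superset u_op_in_K)
  show "u_op (u_op I) \<subseteq> u_op I"
  proof
    fix x assume "x \<in> u_op (u_op I)"
    then obtain J where J: "J \<in> rGV" "x *o J \<subseteq> u_op I"
      by (auto simp: u_op_def)
    obtain S where S: "finite S" "J = tq.span S"
      using J(1) by (rule rGV_obtain_span)
    have "x *o S \<subseteq> u_op I"
      using J(2) S(2) by (auto simp: elt_set_times_subset_iff tq.span_base)
    then obtain P where P: "P \<in> rGV" "\<forall>y\<in>x *o S. y *o P \<subseteq> I"
      using u_op_common_multiplier[OF assms, of "x *o S"] S(1)
      by (auto simp: elt_set_times_eq_image)
    obtain T where T: "finite T" "P = tq.span T"
      using P(1) by (rule rGV_obtain_span)
    \<comment> \<open>Every \<open>x * s\<close> with \<open>s\<close> in \<open>S\<close>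
      multiplies \<open>P\<close> into \<open>I\<close>, which is the two-stage test for the product
      of \<open>J\<close> and \<open>P\<close>.\<close>
    have "x *o tq.span (S * T) \<subseteq> I"
      using P(2) T(2)
      unfolding elt_set_times_span_times_subset_iff[OF assms]
      by (auto simp: elt_set_times_eq_image)
    then show "x \<in> u_op I"
      using rGV_span_times S T J(1) P(1) unfolding u_op_def by blast
  qed
qed

text \<open>The nontrivial inclusion is the requirement that each member of \<open>rGV\<close> has
  inverse \<open>base_ring\<close>.\<close>

lemma u_op_base_ring: "u_op base_ring = base_ring"
  using u_op_superset[OF base_ring_in_K] by (auto simp: u_op_def rGV_iff)

text \<open>If \<open>x\<close> annihilates some \<open>J\<close> in \<open>rGV\<close>, it
  annihilates a unit and hence vanishes.\<close>

lemma u_op_zero: "u_op {0 :: 'a::comm_ring_1 tq} = {0}"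
proof
  show "{0} \<subseteq> u_op {0 :: 'a tq}"
    by (rule u_op_superset) (simp add: K_iff_subspace tq.subspace_0 tq.subspace_single_0)
  show "u_op {0 :: 'a tq} \<subseteq> {0}"
  proof
    fix x :: "'a tq" assume "x \<in> u_op {0}"
    then obtain J where J: "J \<in> rGV" "x *o J \<subseteq> {0}"
      by (auto simp: u_op_def)
    obtain y z where yz: "y \<in> J" "y * z = 1"
      using J(1) by (rule rGV_obtain_unit)
    have "x * y = 0"
      using J(2) yz(1) by (auto simp: elt_set_times_subset_iff)
    then have "x * (y * z) = 0"
      by (simp add: mult.assoc[symmetric])
    then show "x \<in> {0}"
      using yz(2) by simp
  qed
qed

section \<open>Compatibility with multiplication by an element\<close>

lemma elt_set_times_u_op_subset: "a *o u_op I \<subseteq> u_op (a *o I)"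
proof
  fix x assume "x \<in> a *o u_op I"
  then obtain y J where x: "x = a * y" and J: "J \<in> rGV" "y *o J \<subseteq> I"
    by (auto simp: elt_set_times_def u_op_def)
  have "x *o J \<subseteq> a *o I"
    using J(2) by (auto simp: x elt_set_times_eq_image mult.assoc)
  then show "x \<in> u_op (a *o I)"
    using J(1) by (auto simp: u_op_def)
qed

text \<open>
  A unit \<open>y \<in> J\<close> shows that \<open>x J \<subseteq> a I\<close> forces \<open>x\<close> to be a multiple of \<open>a\<close>.
\<close>

lemma elt_set_times_u_op_regular:
  assumes "regular a"
  shows "a *o u_op I = u_op (a *o I)"
proof
  show "u_op (a *o I) \<subseteq> a *o u_op I"
  proof
    fix x assume "x \<in> u_op (a *o I)"
    then obtain J where J: "J \<in> rGV" "x *o J \<subseteq> a *o I"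
      by (auto simp: u_op_def)
    obtain y z where yz: "y \<in> J" "y * z = 1"
      using J(1) by (rule rGV_obtain_unit)
    obtain i where i: "x * y = a * i"
      using J(2) yz(1) by (auto simp: elt_set_times_def)
    have "x = x * y * z"
      using yz(2) by (simp add: mult.assoc)
    then have x: "x = a * (i * z)"
      by (simp add: i mult.assoc)
    \<comment> \<open>Regularity of \<open>a\<close> is used here: cancelling it in
      \<open>a * (i * z * w) = a * k\<close> identifies \<open>i * z * w\<close> with an element of
      \<open>I\<close>.\<close>
    have "(i * z) * w \<in> I" if "w \<in> J" for w
    proof -
      obtain k where "k \<in> I" "x * w = a * k"
        using J(2) \<open>w \<in> J\<close> by (auto simp: elt_set_times_def)
      then show ?thesis
        using regular_cancel[OF assms, of "(i * z) * w" k] by (simp add: x mult.assoc)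
    qed
    then have "i * z \<in> u_op I"
      using J(1) by (auto simp: u_op_def elt_set_times_subset_iff)
    then show "x \<in> a *o u_op I"
      using x by (auto simp: elt_set_times_def)
  qed
qed (rule elt_set_times_u_op_subset)

section \<open>Finite type and the star operation axioms\<close>

lemma u_op_finite_type: "u_op I = \<Union> {u_op I0 | I0. I0 \<in> K \<and> I0 \<subseteq> I \<and> fin_gen I0}"
proof
  show "u_op I \<subseteq> \<Union> {u_op I0 | I0. I0 \<in> K \<and> I0 \<subseteq> I \<and> fin_gen I0}"
  proof
    fix x assume "x \<in> u_op I"
    then obtain J where J: "J \<in> rGV" "x *o J \<subseteq> I"
      by (auto simp: u_op_def)
    \<comment> \<open>The submodule \<open>x *o J\<close> itself serves as \<open>I0\<close>: it
      inherits finite generation from \<open>J\<close>, and the same \<open>J\<close> puts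
      \<open>x\<close> into its image under \<open>u_op\<close>.\<close>
    have "x *o J \<in> K" "fin_gen (x *o J)"
      using J(1) by (simp_all add: rGV_def fractional_ideal_def elt_set_times_in_K
          fin_gen_elt_set_times)
    moreover have "x \<in> u_op (x *o J)"
      using J(1) by (auto simp: u_op_def)
    ultimately show "x \<in> \<Union> {u_op I0 | I0. I0 \<in> K \<and> I0 \<subseteq> I \<and> fin_gen I0}"
      using J(2) by blast
  qed
  show "\<Union> {u_op I0 | I0. I0 \<in> K \<and> I0 \<subseteq> I \<and> fin_gen I0} \<subseteq> u_op I"
    by (rule Union_least) (auto dest: u_op_mono)
qed

lemma star_operation_u_op: "star_operation u_op"
  unfolding star_operation_def
  by (intro conjI ballI allI impI u_op_in_K u_op_base_ring elt_set_times_u_op_subset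
      elt_set_times_u_op_regular u_op_superset u_op_mono u_op_idem)

lemma finite_type_u_op: "finite_type u_op"
  \<comment> \<open>The swap matches the order of the conditions in
    \<open>u_op_finite_type\<close>.\<close>
  unfolding finite_type_def conj_commute[of "fin_gen _"]
  by (intro ballI u_op_finite_type)

lemma reduced_u_op: "reduced u_op"
  by (simp add: reduced_def u_op_zero)

theorem proposition5p1:
  fixes a :: "'a::comm_ring_1 tq" and I J :: "'a tq set"
  assumes "I \<in> K" and "J \<in> K"
  shows "u_op I \<in> K \<and>
    (a *o u_op I \<subseteq> u_op (a *o I) \<and> (regular a \<longrightarrow> a *o u_op I = u_op (a *o I))) \<and>
    (I \<subseteq> u_op I \<and> (I \<subseteq> J \<longrightarrow> u_op I \<subseteq> u_op J)) \<and>
    u_op (u_op I) = u_op I \<and>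
    u_op (base_ring :: 'a tq set) = base_ring \<and>
    u_op {0 :: 'a tq} = {0} \<and>
    u_op I = \<Union> {u_op I0 | I0. I0 \<in> K \<and> I0 \<subseteq> I \<and> fin_gen I0} \<and>
    (star_operation (u_op :: 'a tq set \<Rightarrow> 'a tq set) \<and>
      finite_type (u_op :: 'a tq set \<Rightarrow> 'a tq set) \<and>
      reduced (u_op :: 'a tq set \<Rightarrow> 'a tq set))"
  by (intro conjI impI u_op_in_K elt_set_times_u_op_subset elt_set_times_u_op_regular u_op_superset
      u_op_mono u_op_idem u_op_base_ring u_op_zero u_op_finite_type star_operation_u_op
      finite_type_u_op reduced_u_op assms)

end
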